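(* Let $g:\mathbb{R}^n\to\mathbb{R}$ be $C^\infty$ with gradient $\nabla g$ and Hessian $H$, and let $G=\frac12(\nabla g)^T(\nabla g)$. Let $\Omega\subseteq\mathbb{R}^n$ be a path-connected region on which the inertia of the Hessian is constant, $\nu(H(x))=\{n_+,n_0,n_-\}$ for all $x\in\Omega$, with $n_+\ge 1$. Let $x_0\in\Omega$, and let $V_+=[v_1,\dots,v_{n_+}]$, whose columns are the first $n_+$ (orthonormal) eigenvectors of $H(x_0)$, i.e. those associated with its positive eigenvalues. If $V_+^T\nabla g(x_0)\neq 0$, then there exist a direction $v\in\mathbb{R}^n$ and a scalar $\alpha>0$ such that both $G(x_0+\alpha v)<G(x_0)$ and $g(x_0+\alpha v)<g(x_0)$. Further, if $n_0=0$ (i.e. $H(x_0)$ is hyperbolic), then there exists $\tau>0$ such that $\nu(H(x_0+\tau v))=\nu(H(x_0))$. Finally, in all cases above, the direction $v$ can be taken as $v=-(H_+(x_0))^{\dagger}\nabla g(x_0)$, where $H_+$ is the closest positive semidefinite matrix to $H$; that is, writing $H(x_0)=V\Lambda V^T$ with $\Lambda=\mathrm{diag}(\Lambda_+,\Lambda_0,\Lambda_-)$, one has $H_+(x_0)=V\,\mathrm{diag}(\Lambda_+,0_{n_0},0_{n_-})\,V^T$, and thus $(H_+(x_0))^{\dagger}=V_+(\Lambda_+)^{-1}V_+^T$.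
   Context: For a symmetric matrix $A$, the inertia $\nu(A)=\{n_+(A),n_0(A),n_-(A)\}$ is the (ordered) triplet of the numbers of positive, zero and negative eigenvalues of $A$, counted with multiplicity; $A$ is called hyperbolic if $n_0(A)=0$. The eigenvalues of $H(x_0)$ are ordered $\lambda_1\ge\lambda_2\ge\cdots\ge\lambda_n$, with corresponding orthonormal eigenvectors $v_1,\dots,v_n$, and $V=[v_1,\dots,v_n]=[V_+,V_0,V_-]$ is partitioned according to the positive, zero and negative eigenvalues. Correspondingly $\Lambda_+$, $\Lambda_0$, $\Lambda_-$ are the diagonal matrices of the positive, zero and negative eigenvalues, and $0_m$ is the $m\times m$ zero matrix. The symbol $\dagger$ denotes the Moore–Penrose pseudoinverse. *)

theory Defs
  imports "HOL-Analysis.Analysis" "HOL-Computational_Algebra.Computational_Algebra"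
begin

definition partial :: "'n::finite \<Rightarrow> (real^'n \<Rightarrow> real) \<Rightarrow> real^'n \<Rightarrow> real" where
  "partial i f x = frechet_derivative f (at x) (axis i 1)"

text \<open>
  \<open>Ck k f\<close> says that \<open>f\<close> is \<open>k\<close> times continuously differentiable. Total differentiability at each
  step makes \<^const>\<open>frechet_derivative\<close> meaningful; it costs nothing, since a function with continuous
  partial derivatives is totally differentiable.
\<close>

primrec Ck :: "nat \<Rightarrow> (real^'n::finite \<Rightarrow> real) \<Rightarrow> bool" where
  "Ck 0 f \<longleftrightarrow> continuous_on UNIV f"
| "Ck (Suc k) f \<longleftrightarrow> (\<forall>x. f differentiable (at x)) \<and> (\<forall>i. Ck k (partial i f))"

definition smooth :: "(real^'n::finite \<Rightarrow> real) \<Rightarrow> bool" where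
  "smooth f \<longleftrightarrow> (\<forall>k. Ck k f)"

definition gradient :: "(real^'n::finite \<Rightarrow> real) \<Rightarrow> real^'n \<Rightarrow> real^'n" where
  "gradient f x = (\<chi> i. partial i f x)"

definition hessian :: "(real^'n::finite \<Rightarrow> real) \<Rightarrow> real^'n \<Rightarrow> real^'n^'n" where
  "hessian f x = (\<chi> i j. partial j (partial i f) x)"

definition half_grad_sq :: "(real^'n::finite \<Rightarrow> real) \<Rightarrow> real^'n \<Rightarrow> real" where
  "half_grad_sq f x = 1/2 * (gradient f x \<bullet> gradient f x)"

definition diag_mat :: "('n::finite \<Rightarrow> real) \<Rightarrow> real^'n^'n" where
  "diag_mat d = (\<chi> i j. if i = j then d i else 0)"

text \<open>The polynomial \<open>det (t I - A)\<close>; its multiset of real roots is the multiset of real eigenvalues.\<close>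

definition charpoly :: "real^'n::finite^'n \<Rightarrow> real poly" where
  "charpoly A = det (\<chi> i j. if i = j then [:- (A $ i $ j), 1:] else [:- (A $ i $ j):])"

definition eigvals :: "real^'n::finite^'n \<Rightarrow> real multiset" where
  "eigvals A = proots (charpoly A)"

text \<open>The triple \<open>(n\<^sub>+, n\<^sub>0, n\<^sub>-)\<close>.\<close>

definition inertia :: "real^'n::finite^'n \<Rightarrow> nat \<times> nat \<times> nat" where
  "inertia A = (size (filter_mset (\<lambda>t. t > 0) (eigvals A)),
                size (filter_mset (\<lambda>t. t = 0) (eigvals A)),
                size (filter_mset (\<lambda>t. t < 0) (eigvals A)))"

definition pos_semidef :: "real^'n::finite^'n \<Rightarrow> bool" where
  "pos_semidef A \<longleftrightarrow> transpose A = A \<and> (\<forall>x. 0 \<le> x \<bullet> (A *v x))"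

text \<open>
  The norm of \<open>real^'n^'n\<close> is the Frobenius norm. (In the operator norm a closest positive
  semidefinite matrix need not be unique.)
\<close>

definition is_nearest_psd :: "real^'n::finite^'n \<Rightarrow> real^'n^'n \<Rightarrow> bool" where
  "is_nearest_psd A P \<longleftrightarrow> is_arg_min (\<lambda>Q. norm (A - Q)) pos_semidef P"

definition nearest_psd :: "real^'n::finite^'n \<Rightarrow> real^'n^'n" where
  "nearest_psd A = (THE P. is_nearest_psd A P)"

definition is_pinv :: "real^'n::finite^'m::finite \<Rightarrow> real^'m^'n \<Rightarrow> bool" where
  "is_pinv A X \<longleftrightarrow>
     A ** X ** A = A \<and> X ** A ** X = X \<and>
     transpose (A ** X) = A ** X \<and> transpose (X ** A) = X ** A"

definition pinv :: "real^'n::finite^'m::finite \<Rightarrow> real^'m^'n" where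
  "pinv A = (THE X. is_pinv A X)"

lemma is_pinv_unique:
  assumes X: "is_pinv A X" and Y: "is_pinv A Y"
  shows "X = Y"
proof -
  have aX: "A ** X ** A = A" "X ** A ** X = X" "transpose (A ** X) = A ** X" "transpose (X ** A) = X ** A"
    and aY: "A ** Y ** A = A" "Y ** A ** Y = Y" "transpose (A ** Y) = A ** Y" "transpose (Y ** A) = Y ** A"
    using X Y by (auto simp: is_pinv_def)
  have "A ** X = transpose ((A ** Y ** A) ** X)"
    using aX aY by simp
  also have "\<dots> = transpose ((A ** Y) ** (A ** X))"
    by (simp add: matrix_mul_assoc)
  also have "\<dots> = (A ** X ** A) ** Y"
    by (metis matrix_transpose_mul aX(3) aY(3) matrix_mul_assoc)
  finally have 1: "A ** X = A ** Y"
    using aX by simp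
  have "X ** A = transpose (X ** (A ** Y ** A))"
    using aX aY by simp
  also have "\<dots> = transpose ((X ** A) ** (Y ** A))"
    by (simp add: matrix_mul_assoc)
  also have "\<dots> = Y ** (A ** X ** A)"
    by (metis matrix_transpose_mul aX(4) aY(4) matrix_mul_assoc)
  finally have 2: "X ** A = Y ** A"
    using aX by simp
  show ?thesis
    by (metis 1 2 aX(2) aY(2) matrix_mul_assoc)
qed

lemma pinv_eqI: "is_pinv A X \<Longrightarrow> pinv A = X"
  unfolding pinv_def using is_pinv_unique by blast

lemma pos_semidef_midpoint:
  assumes "pos_semidef P" "pos_semidef Q"
  shows "pos_semidef ((1/2) *\<^sub>R (P + Q))"
proof -
  have "((1/2) *\<^sub>R (P + Q)) *v x = (1/2) *\<^sub>R (P *v x + Q *v x)" for x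
    by (simp add: scaleR_matrix_vector_assoc[symmetric] matrix_vector_mult_add_rdistrib)
  moreover have "transpose ((1/2) *\<^sub>R (P + Q)) = (1/2) *\<^sub>R (transpose P + transpose Q)"
    by (simp add: transpose_def vec_eq_iff)
  ultimately show ?thesis
    using assms by (auto simp: pos_semidef_def inner_add_right)
qed

lemma is_nearest_psd_unique:
  assumes P: "is_nearest_psd A P" and Q: "is_nearest_psd A Q"
  shows "P = Q"
proof (rule ccontr)
  assume "P \<noteq> Q"
  have psd: "pos_semidef P" "pos_semidef Q"
    and min: "\<And>R. pos_semidef R \<Longrightarrow> norm (A - P) \<le> norm (A - R)"
    and eq: "norm (A - P) = norm (A - Q)"
    using P Q by (auto simp: is_nearest_psd_def is_arg_min_linorder intro: antisym)
  have parallelogram: "(norm (a + b))\<^sup>2 = 2 * (norm a)\<^sup>2 + 2 * (norm b)\<^sup>2 - (norm (a - b))\<^sup>2"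
    for a b :: "real^'a^'a"
    by (simp add: power2_norm_eq_inner inner_add inner_diff inner_commute)
  define M where "M = (1/2) *\<^sub>R (P + Q)"
  have le: "norm (A - P) \<le> norm (A - M)"
    unfolding M_def by (intro min pos_semidef_midpoint psd)
  have "A - M = (1/2) *\<^sub>R ((A - P) + (A - Q))"
    by (simp add: M_def vec_eq_iff field_simps)
  then have "(norm (A - M))\<^sup>2 = (1/4) * (norm ((A - P) + (A - Q)))\<^sup>2"
    by (simp add: power2_eq_square)
  also have "(norm ((A - P) + (A - Q)))\<^sup>2
      = 2 * (norm (A - P))\<^sup>2 + 2 * (norm (A - Q))\<^sup>2 - (norm ((A - P) - (A - Q)))\<^sup>2"
    using parallelogram by blast
  finally have "(norm (A - M))\<^sup>2 = (norm (A - P))\<^sup>2 - (1/4) * (norm (Q - P))\<^sup>2"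
    by (simp add: eq)
  moreover have "norm (Q - P) > 0"
    using \<open>P \<noteq> Q\<close> by simp
  ultimately have "(norm (A - M))\<^sup>2 < (norm (A - P))\<^sup>2"
    by simp
  with le show False
    by (meson norm_ge_zero not_le power_mono)
qed

lemma nearest_psd_eqI: "is_nearest_psd A P \<Longrightarrow> nearest_psd A = P"
  unfolding nearest_psd_def using is_nearest_psd_unique by blast

definition descends :: "(real^'n::finite \<Rightarrow> real) \<Rightarrow> real^'n \<Rightarrow> real^'n \<Rightarrow> bool" where
  "descends g x0 v \<longleftrightarrow>
     (\<exists>\<alpha>>0. half_grad_sq g (x0 + \<alpha> *\<^sub>R v) < half_grad_sq g x0 \<and> g (x0 + \<alpha> *\<^sub>R v) < g x0)"

definition preserves_inertia :: "(real^'n::finite \<Rightarrow> real) \<Rightarrow> real^'n \<Rightarrow> real^'n \<Rightarrow> bool" where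
  "preserves_inertia g x0 v \<longleftrightarrow>
     (\<exists>\<tau>>0. inertia (hessian g (x0 + \<tau> *\<^sub>R v)) = inertia (hessian g x0))"

end

(* With X = (H_+)^dagger and w = - X grad g, the slopes at x0 along w are
     - grad g . X grad g  for g    and    - grad g . H X grad g  for G.
   Both X and H X are positive semidefinite and vanish exactly on the orthogonal complement of the
   positive eigenvectors, so both slopes are negative as soon as V_+^T grad g is nonzero.

   The projection formula for H_+ is the variational inequality  <H - H_+, Q> <= 0 = <H - H_+, H_+>
   for positive semidefinite Q.

   If H(x0) is nonsingular, then H(x) for x near x0 is still definite on the positive and on the
   negative eigenspace of H(x0). By the spectral theorem for the symmetric matrix H(x) and a dimension
   count, it has at least as many eigenvalues of each sign, hence the same inertia. *)

theory Submission
  imports Defs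
begin

unbundle no fps_syntax

subsection \<open>Spectral decompositions\<close>

text \<open>The column index type is independent of the row index type, so that V and the narrower
  V_+ are both of this shape.\<close>

definition col_mat :: "('m \<Rightarrow> real^'n::finite) \<Rightarrow> real^'m::finite^'n" where
  "col_mat u = (\<chi> i j. u j $ i)"

text \<open>Indexing the frame by \<open>'n\<close> itself turns multiplicities into cardinalities
  of index sets, with no order on the eigenvalues.\<close>

definition eigenframe :: "real^'n::finite^'n \<Rightarrow> ('n \<Rightarrow> real^'n) \<Rightarrow> ('n \<Rightarrow> real) \<Rightarrow> bool" where
  "eigenframe A u d \<longleftrightarrow>
     (\<forall>i j. u i \<bullet> u j = (if i = j then 1 else 0)) \<and> (\<forall>i. A *v u i = d i *\<^sub>R u i)"

text \<open>The sum of the matrices d_j u_j u_j^T. The Hessian at x0, its closest semidefinite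
  matrix and the pseudoinverse of the latter all take this form with one and the same
  \<open>u\<close>.\<close>

definition spectral_mat :: "('n::finite \<Rightarrow> real^'n) \<Rightarrow> ('n \<Rightarrow> real) \<Rightarrow> real^'n^'n" where
  "spectral_mat u d = col_mat u ** diag_mat d ** transpose (col_mat u)"

section \<open>Diagonal matrices; entries, Frobenius products and quadratic forms of spectral
  matrices\<close>

lemma diag_mat_mult: "diag_mat a ** diag_mat b = diag_mat (\<lambda>i. a i * b i)"
  by (simp add: diag_mat_def matrix_matrix_mult_def vec_eq_iff mult_delta_left mult_delta_right)

lemma matrix_inv_eqI:
  fixes A B :: "real^'n::finite^'n"
  assumes "A ** B = mat 1"
  shows "matrix_inv A = B"
proof -
  have BA: "B ** A = mat 1"
    using assms matrix_left_right_inverse by blast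
  then have "A ** matrix_inv A = mat 1"
    unfolding matrix_inv_def
    using assms someI[of "\<lambda>A'. A ** A' = mat 1 \<and> A' ** A = mat 1" B] by blast
  then have "B ** A ** matrix_inv A = B"
    unfolding matrix_mul_assoc[symmetric] by simp
  then show ?thesis
    by (simp add: BA)
qed

lemma matrix_inv_diag_mat:
  assumes "\<And>i. d i \<noteq> 0"
  shows "matrix_inv (diag_mat d) = diag_mat (\<lambda>i. inverse (d i))"
  using assms by (intro matrix_inv_eqI) (simp add: diag_mat_mult, simp add: diag_mat_def mat_def)

lemma diag_mat_vector: "diag_mat a *v x = (\<chi> i. a i * x $ i)"
  by (simp add: diag_mat_def matrix_vector_mult_def vec_eq_iff mult_delta_left mult_delta_right)

lemma transpose_col_mat_vector: "transpose (col_mat u) *v x = (\<chi> j. u j \<bullet> x)"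
  by (simp add: col_mat_def transpose_def matrix_vector_mult_def inner_vec_def vec_eq_iff
      del: transpose_matrix_vector)

lemma col_mat_diag_component:
  "(col_mat u ** diag_mat d ** transpose (col_mat u)) $ i $ k = (\<Sum>j\<in>UNIV. d j * (u j $ i * u j $ k))"
  by (simp add: col_mat_def diag_mat_def transpose_def matrix_matrix_mult_def mult_delta_left mult_delta_right algebra_simps)

lemma spectral_mat_component:
  "spectral_mat u d $ i $ k = (\<Sum>j\<in>UNIV. d j * (u j $ i * u j $ k))"
  by (simp add: spectral_mat_def col_mat_diag_component)

text \<open>The Frobenius product of B with the rank-one matrix u_j u_j^T is the quadratic form of B
  at u_j.\<close>

lemma inner_spectral_mat: "B \<bullet> spectral_mat u d = (\<Sum>j\<in>UNIV. d j * (u j \<bullet> (B *v u j)))"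
proof -
  have "B \<bullet> spectral_mat u d = (\<Sum>i\<in>UNIV. \<Sum>k\<in>UNIV. \<Sum>j\<in>UNIV. d j * (u j $ i * (B $ i $ k * u j $ k)))"
    by (simp add: inner_vec_def spectral_mat_component sum_distrib_left algebra_simps)
  also have "\<dots> = (\<Sum>i\<in>UNIV. \<Sum>j\<in>UNIV. \<Sum>k\<in>UNIV. d j * (u j $ i * (B $ i $ k * u j $ k)))"
    by (intro sum.cong sum.swap refl)
  also have "\<dots> = (\<Sum>j\<in>UNIV. \<Sum>i\<in>UNIV. \<Sum>k\<in>UNIV. d j * (u j $ i * (B $ i $ k * u j $ k)))"
    by (rule sum.swap)
  finally show ?thesis
    by (simp add: inner_vec_def matrix_vector_mult_def sum_distrib_left)
qed

lemma spectral_mat_diff: "spectral_mat u a - spectral_mat u b = spectral_mat u (\<lambda>i. a i - b i)"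
  by (simp add: vec_eq_iff spectral_mat_component sum_subtractf algebra_simps)

text \<open>In the coordinates u_i . x the form is diagonal, which turns definiteness into a
  question about the signs of the weights \<open>d i\<close>.\<close>

lemma inner_vector_spectral_mat:
  "x \<bullet> (spectral_mat u d *v y) = (\<Sum>i\<in>UNIV. d i * (u i \<bullet> x) * (u i \<bullet> y))"
proof -
  have "x \<bullet> (spectral_mat u d *v y) = (transpose (col_mat u) *v x) \<bullet> (diag_mat d *v (transpose (col_mat u) *v y))"
    by (simp add: spectral_mat_def dot_lmul_matrix matrix_vector_mul_assoc[symmetric] del: vector_transpose_matrix)
  also have "\<dots> = (\<Sum>i\<in>UNIV. d i * (u i \<bullet> x) * (u i \<bullet> y))"
    unfolding transpose_col_mat_vector diag_mat_vector by (simp add: inner_vec_def[of "\<chi> j. _ j"] algebra_simps)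
  finally show ?thesis .
qed

text \<open>One nonzero coordinate with a positive weight suffices. Used with the weights of X and
  of H X, this gives the signs of the two slopes.\<close>

lemma inner_spectral_mat_pos:
  assumes "\<And>i. 0 \<le> c i" "0 < c j" "u j \<bullet> x \<noteq> 0"
  shows "0 < x \<bullet> (spectral_mat u c *v x)"
  unfolding inner_vector_spectral_mat mult.assoc
  using assms by (intro sum_pos2[of _ j]) (auto simp: zero_less_mult_iff not_less less_le)

lemma transpose_spectral_mat [simp]: "transpose (spectral_mat u d) = spectral_mat u d"
  by (simp add: vec_eq_iff transpose_def spectral_mat_component mult.commute)

lemma pos_semidef_spectral_mat:
  assumes "\<And>i. 0 \<le> d i"
  shows "pos_semidef (spectral_mat u d)"
  unfolding pos_semidef_def inner_vector_spectral_mat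
  using assms by (auto intro!: sum_nonneg simp: mult.assoc)

section \<open>Products, pseudoinverse and nearest semidefinite matrix in a fixed orthonormal
  frame\<close>

locale orthonormal_frame =
  fixes u :: "'n::finite \<Rightarrow> real^'n"
  assumes orthonormal: "u i \<bullet> u j = (if i = j then 1 else 0)"
begin

lemma col_mat_left: "transpose (col_mat u) ** col_mat u = mat 1"
  using orthonormal
  by (simp add: col_mat_def transpose_def matrix_matrix_mult_def mat_def inner_vec_def vec_eq_iff)

lemma col_mat_right: "col_mat u ** transpose (col_mat u) = mat 1"
  using col_mat_left matrix_left_right_inverse by blast

text \<open>The inner factor U^T U cancels, so identities between such matrices reduce to scalar
  identities between their weights.\<close>

lemma spectral_mat_mult: "spectral_mat u a ** spectral_mat u b = spectral_mat u (\<lambda>i. a i * b i)"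
proof -
  have "spectral_mat u a ** spectral_mat u b
      = col_mat u ** diag_mat a ** (transpose (col_mat u) ** col_mat u) ** diag_mat b ** transpose (col_mat u)"
    by (simp add: spectral_mat_def matrix_mul_assoc)
  also have "\<dots> = col_mat u ** (diag_mat a ** diag_mat b) ** transpose (col_mat u)"
    by (simp add: col_mat_left matrix_mul_assoc)
  finally show ?thesis
    by (simp add: diag_mat_mult spectral_mat_def)
qed

lemma spectral_mat_1: "spectral_mat u (\<lambda>_. 1) = mat 1"
proof -
  have "diag_mat (\<lambda>_. 1) = (mat 1 :: real^'n^'n)"
    by (simp add: diag_mat_def mat_def)
  then show ?thesis
    by (simp add: spectral_mat_def col_mat_right)
qed

lemma inner_expand: "x \<bullet> y = (\<Sum>i\<in>UNIV. (u i \<bullet> x) * (u i \<bullet> y))"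
  using inner_vector_spectral_mat[of x u "\<lambda>_. 1" y] by (simp add: spectral_mat_1)

lemma eigenframe_imp_spectral_mat:
  assumes "eigenframe A u d"
  shows "A = spectral_mat u d"
proof -
  have "A ** col_mat u = col_mat u ** diag_mat d"
    using assms
    by (simp add: eigenframe_def col_mat_def diag_mat_def matrix_matrix_mult_def vec_eq_iff
        matrix_vector_mult_def mult_delta_right mult.commute)
  then show ?thesis
    by (metis col_mat_right matrix_mul_assoc matrix_mul_rid spectral_mat_def)
qed

text \<open>The Penrose equations become scalar ones for each weight; at a zero weight they hold
  because \<open>inverse 0 = 0\<close>.\<close>

lemma is_pinv_spectral_mat:
  "is_pinv (spectral_mat u d) (spectral_mat u (\<lambda>i. inverse (d i)))"
proof -
  have "(\<lambda>i. d i * inverse (d i) * d i) = d"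
    and "(\<lambda>i. inverse (d i) * d i * inverse (d i)) = (\<lambda>i. inverse (d i))"
    by (rule ext, rename_tac i, case_tac "d i = 0"; simp)+
  then show ?thesis
    unfolding is_pinv_def spectral_mat_mult by simp
qed

lemma is_nearest_psd_spectral_mat:
  "is_nearest_psd (spectral_mat u d) (spectral_mat u (\<lambda>i. max 0 (d i)))"
proof -
  let ?A = "spectral_mat u d" and ?P = "spectral_mat u (\<lambda>i. max 0 (d i))"
  have "norm (?A - ?P) \<le> norm (?A - Q)" if Q: "pos_semidef Q" for Q
  proof -
    have AP: "?A - ?P = spectral_mat u (\<lambda>i. min 0 (d i))"
      by (auto simp: spectral_mat_diff min_def max_def intro!: arg_cong[of _ _ "spectral_mat u"])
    have "Q \<bullet> (?A - ?P) \<le> 0"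
      using Q unfolding AP inner_spectral_mat
      by (auto intro!: sum_nonpos mult_nonpos_nonneg simp: pos_semidef_def)
    \<comment> \<open>Each index contributes zero, since one of \<open>min 0 (d i)\<close> and
      \<open>max 0 (d i)\<close> vanishes.\<close>
    moreover have "?P \<bullet> (?A - ?P) = 0"
      unfolding AP inner_spectral_mat inner_vector_spectral_mat
      by (intro sum.neutral ballI) (auto simp: orthonormal mult_delta_left mult_delta_right min_def max_def)
    ultimately have "0 \<le> (?P - Q) \<bullet> (?A - ?P)"
      by (simp add: inner_diff_left)
    \<comment> \<open>The square of A - Q = (A - P) + (P - Q), whose cross term was just shown to be
      nonnegative.\<close>
    moreover have "(norm (?A - Q))\<^sup>2 = (norm (?A - ?P))\<^sup>2 + 2 * ((?P - Q) \<bullet> (?A - ?P)) + (norm (?P - Q))\<^sup>2"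
      by (simp add: power2_norm_eq_inner inner_diff inner_commute)
    ultimately have "(norm (?A - ?P))\<^sup>2 \<le> (norm (?A - Q))\<^sup>2"
      by simp
    then show ?thesis
      by (rule power2_le_imp_le) simp
  qed
  then show ?thesis
    by (simp add: is_nearest_psd_def is_arg_min_linorder pos_semidef_spectral_mat)
qed

end

lemma eigenframe_orthonormal_frame: "eigenframe A u d \<Longrightarrow> orthonormal_frame u"
  by (simp add: eigenframe_def orthonormal_frame_def)

lemma eigenframe_eq_spectral_mat: "eigenframe A u d \<Longrightarrow> A = spectral_mat u d"
  using eigenframe_orthonormal_frame orthonormal_frame.eigenframe_imp_spectral_mat by blast

subsection \<open>Inertia from an orthonormal eigenbasis\<close>

definition poly_mat :: "real^'n::finite^'m::finite \<Rightarrow> real poly^'n^'m" where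
  "poly_mat A = (\<chi> i j. [:A $ i $ j:])"

lemma poly_mat_mult: "poly_mat (A ** B) = poly_mat A ** poly_mat B"
  by (simp add: poly_mat_def matrix_matrix_mult_def vec_eq_iff flip: sum_to_poly)
     (simp add: mult.commute)

lemma poly_mat_1: "poly_mat (mat 1) = mat 1"
  by (auto simp: poly_mat_def mat_def vec_eq_iff)

lemma charpoly_eq: "charpoly A = det (mat [:0, 1:] - poly_mat A)"
  unfolding charpoly_def by (rule arg_cong[of _ _ det]) (auto simp: mat_def poly_mat_def vec_eq_iff)

lemma mat_commute: "P ** mat c = mat c ** (P :: 'a::comm_semiring_1^'n::finite^'n)"
  by (auto simp: mat_def matrix_matrix_mult_def vec_eq_iff mult_delta_left mult_delta_right mult.commute)

text \<open>Scalar matrices are central, so conjugating X I - B yields X I - P B Q. With P and Q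
  lifted to constant polynomials by \<open>poly_mat\<close>, the determinant is multiplicative over
  the polynomial ring, where det P and det Q cancel.\<close>

lemma charpoly_similar:
  fixes P Q B :: "real^'n::finite^'n"
  assumes "P ** Q = mat 1"
  shows "charpoly (P ** B ** Q) = charpoly B"
proof -
  let ?P = "poly_mat P" and ?Q = "poly_mat Q" and ?X = "mat [:0, 1:]"
  have PQ: "?P ** ?Q = mat 1"
    using assms by (metis poly_mat_1 poly_mat_mult)
  have "?P ** (?X - poly_mat B) ** ?Q = (?P ** ?X) ** ?Q - ?P ** poly_mat B ** ?Q"
    by (simp add: matrix_matrix_mult_def vec_eq_iff sum_subtractf algebra_simps)
  also have "(?P ** ?X) ** ?Q = ?X ** (?P ** ?Q)"
    by (simp only: mat_commute[of ?P] matrix_mul_assoc)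
  also have "\<dots> = ?X"
    by (simp add: PQ)
  finally have "?P ** (?X - poly_mat B) ** ?Q = ?X - poly_mat (P ** B ** Q)"
    by (simp add: poly_mat_mult)
  then have "charpoly (P ** B ** Q) = det ?P * charpoly B * det ?Q"
    by (simp only: charpoly_eq det_mul[symmetric])
  also have "\<dots> = (det ?P * det ?Q) * charpoly B"
    by (simp add: algebra_simps)
  also have "det ?P * det ?Q = 1"
    by (metis PQ det_I det_mul)
  finally show ?thesis by simp
qed

lemma charpoly_diag_mat: "charpoly (diag_mat d) = (\<Prod>i\<in>UNIV. [:- d i, 1:])"
  unfolding charpoly_def by (subst det_diagonal) (auto simp: diag_mat_def)

text \<open>The matrix is similar to a diagonal one, whose characteristic polynomial splits into the
  linear factors t - d_i.\<close>

lemma eigvals_eigenframe: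
  assumes "eigenframe A u d"
  shows "eigvals A = image_mset d (mset_set UNIV)"
proof -
  have "charpoly A = charpoly (diag_mat d)"
    using assms eigenframe_eq_spectral_mat[OF assms]
      orthonormal_frame.col_mat_right[OF eigenframe_orthonormal_frame[OF assms]]
    by (simp add: spectral_mat_def charpoly_similar)
  then have "eigvals A = (\<Sum>i\<in>UNIV. proots [:- d i, 1:])"
    by (simp add: eigvals_def charpoly_diag_mat proots_prod)
  then show ?thesis
    by (simp add: sum_unfold_sum_mset)
qed

lemma inertia_eigenframe:
  assumes "eigenframe A u d"
  shows "inertia A = (card {i. 0 < d i}, card {i. d i = 0}, card {i. d i < 0})"
  by (simp add: inertia_def eigvals_eigenframe[OF assms] filter_mset_image_mset filter_mset_mset_set)

text \<open>In a nonincreasing list the positive entries form an initial segment, whose length is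
  their number. This identifies the first \<open>np\<close> eigenvectors with those of positive
  eigenvalue.\<close>

lemma pos_iff_le_card_pos:
  fixes lam :: "nat \<Rightarrow> real"
  assumes ordered: "\<And>i j. 1 \<le> i \<Longrightarrow> i \<le> j \<Longrightarrow> j \<le> n \<Longrightarrow> lam j \<le> lam i"
    and i: "i \<in> {1..n}"
  shows "0 < lam i \<longleftrightarrow> i \<le> card {k \<in> {1..n}. 0 < lam k}"
proof
  assume pos: "0 < lam i"
  have "{1..i} \<subseteq> {k \<in> {1..n}. 0 < lam k}"
    using i pos ordered by (auto intro: less_le_trans)
  then have "card {1..i} \<le> card {k \<in> {1..n}. 0 < lam k}"
    by (intro card_mono) auto
  then show "i \<le> card {k \<in> {1..n}. 0 < lam k}"
    by simp
next
  assume le: "i \<le> card {k \<in> {1..n}. 0 < lam k}"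
  show "0 < lam i"
  proof (rule ccontr)
    assume nonpos: "\<not> 0 < lam i"
    have "k < i" if k: "k \<in> {1..n}" "0 < lam k" for k
    proof (rule ccontr)
      assume "\<not> k < i"
      then have "lam k \<le> lam i"
        using i k by (intro ordered) auto
      with k nonpos show False by simp
    qed
    then have "{k \<in> {1..n}. 0 < lam k} \<subseteq> {1..<i}"
      by auto
    then have "card {k \<in> {1..n}. 0 < lam k} \<le> card {1..<i}"
      by (intro card_mono) auto
    moreover have "card {1..<i} < i"
      using i by simp
    ultimately show False
      using le by linarith
  qed
qed

subsection \<open>Spectral theorem for real symmetric matrices\<close>

lemma symmetric_matrix_inner:
  fixes A :: "real^'n::finite^'n"
  assumes "transpose A = A"
  shows "x \<bullet> (A *v y) = (A *v x) \<bullet> y"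
  by (metis assms dot_lmul_matrix transpose_matrix_vector)

text \<open>A maximiser of the Rayleigh quotient on the invariant subspace is an eigenvector.\<close>

lemma symmetric_matrix_eigenvector_in_subspace:
  fixes A :: "real^'n::finite^'n"
  assumes sym: "transpose A = A" and S: "subspace S"
    and invariant: "\<And>x. x \<in> S \<Longrightarrow> A *v x \<in> S"
    and nontrivial: "y \<in> S" "y \<noteq> 0"
  obtains u c where "u \<in> S" "norm u = 1" "A *v u = c *\<^sub>R u"
proof -
  let ?K = "S \<inter> sphere 0 1"
  have "compact ?K"
    using S closed_Int_compact closed_subspace compact_sphere by blast
  moreover have "(1 / norm y) *\<^sub>R y \<in> ?K"
    using S nontrivial by (auto simp: subspace_scale)
  moreover have "continuous_on ?K (\<lambda>x. x \<bullet> (A *v x))"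
    by (intro continuous_intros linear_continuous_on) auto
  ultimately obtain u where u: "u \<in> ?K" and max: "\<And>x. x \<in> ?K \<Longrightarrow> x \<bullet> (A *v x) \<le> u \<bullet> (A *v u)"
    using continuous_attains_sup[of ?K "\<lambda>x. x \<bullet> (A *v x)"] by blast
  define m where "m = u \<bullet> (A *v u)"
  have uu: "u \<bullet> u = 1" and uS: "u \<in> S" and nu: "norm u = 1"
    using u by (auto simp: norm_eq_1)
  have le: "x \<bullet> (A *v x) \<le> m * (x \<bullet> x)" if "x \<in> S" for x
  proof (cases "x = 0")
    case False
    have "((1 / norm x) *\<^sub>R x) \<bullet> (A *v ((1 / norm x) *\<^sub>R x)) \<le> m"
      unfolding m_def using False that S by (intro max) (auto simp: subspace_scale)
    then have "(x \<bullet> (A *v x)) / (norm x)\<^sup>2 \<le> m"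
      by (simp add: matrix_vector_mult_scaleR power2_eq_square)
    then show ?thesis
      using False by (simp add: divide_le_eq power2_norm_eq_inner)
  qed simp
  \<comment> \<open>First-order condition at the maximiser, in the directions of S orthogonal to
    u.\<close>
  have orth: "x \<bullet> (A *v u) = 0" if x: "x \<in> S" "x \<bullet> u = 0" for x
  proof -
    define k where "k = x \<bullet> (A *v u)"
    define c where "c = m * (x \<bullet> x) - x \<bullet> (A *v x)"
    have c: "c \<ge> 0"
      using le x by (simp add: c_def)
    \<comment> \<open>This is the bound \<open>le\<close> at u + t x, where the terms of order zero
      in t cancel.\<close>
    have quad: "2 * t * k \<le> t\<^sup>2 * c" for t
    proof -
      have ux: "u \<bullet> (A *v x) = k"
        using symmetric_matrix_inner[OF sym, of u x] by (simp add: k_def inner_commute)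
      have "u + t *\<^sub>R x \<in> S"
        using S uS x by (simp add: subspace_add subspace_scale)
      from le[OF this] show ?thesis
        using x ux uu
        by (simp add: matrix_vector_right_distrib matrix_vector_mult_scaleR inner_add inner_commute
            c_def algebra_simps power2_eq_square m_def[symmetric] k_def[symmetric])
    qed
    \<comment> \<open>Taking t = s k gives k^2 s (2 - s c) \<le> 0. The added 1 keeps s defined and
      positive when c = 0 and makes s c < 1, which forces k = 0.\<close>
    define s where "s = 1 / (c + 1)"
    have s: "s > 0" "s * c < 1"
      using c by (auto simp: s_def)
    have "k\<^sup>2 * (s * (2 - s * c)) \<le> 0"
      using quad[of "s * k"] by (simp add: algebra_simps power2_eq_square)
    moreover have "s * (2 - s * c) > 0"
      using s by simp
    ultimately show ?thesis
      by (metis k_def linorder_not_less mult_pos_pos zero_less_power2)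
  qed
  \<comment> \<open>The residual lies in S and is orthogonal to u, so by the first-order condition
    it is orthogonal to A u as well, hence to itself.\<close>
  let ?r = "A *v u - m *\<^sub>R u"
  have rS: "?r \<in> S"
    using S uS invariant by (simp add: subspace_diff subspace_scale)
  have ru: "?r \<bullet> u = 0"
    by (simp add: inner_diff_left uu m_def inner_commute[of "A *v u"])
  have "?r \<bullet> ?r = ?r \<bullet> (A *v u) - m * (?r \<bullet> u)"
    by (simp only: inner_diff_right inner_scaleR_right)
  also have "\<dots> = 0"
    using orth[OF rS ru] ru by simp
  finally have "A *v u = m *\<^sub>R u"
    by simp
  with uS nu that show ?thesis by blast
qed

text \<open>A largest orthonormal set of eigenvectors is a basis: otherwise its orthogonal
  complement is a nonzero invariant subspace and holds a further eigenvector.\<close>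

theorem symmetric_matrix_eigenframe:
  fixes A :: "real^'n::finite^'n"
  assumes sym: "transpose A = A"
  obtains u d where "eigenframe A u d"
proof -
  define P where "P B \<longleftrightarrow> pairwise orthogonal B \<and> (\<forall>x\<in>B. norm x = 1 \<and> (\<exists>c. A *v x = c *\<^sub>R x))"
    for B :: "(real^'n) set"
  have indep: "independent B" if "P B" for B
    using that by (intro pairwise_orthogonal_independent) (auto simp: P_def)
  have bound: "finite B \<and> card B \<le> CARD('n)" if "P B" for B
    using independent_bound[OF indep[OF that]] by simp
  have "P {}"
    by (simp add: P_def)
  then obtain B where B: "P B" and max: "\<And>C. P C \<Longrightarrow> card C \<le> card B"
    using ex_has_greatest_nat[of P "{}" card "Suc CARD('n)"] bound by (auto simp: less_Suc_eq_le)
  have "card B = CARD('n)"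
  proof (rule ccontr)
    assume "card B \<noteq> CARD('n)"
    then have "dim (span B) < DIM(real^'n)"
      using bound[OF B] indep[OF B] by (simp add: dim_eq_card_independent)
    then obtain y where y: "y \<noteq> 0" "\<And>x. x \<in> span B \<Longrightarrow> orthogonal y x"
      using orthogonal_to_subspace_exists by (metis dim_span)
    let ?W = "{x. \<forall>b\<in>B. b \<bullet> x = 0}"
    have "subspace ?W"
      by (auto simp: subspace_def inner_add_right)
    \<comment> \<open>By symmetry b . A x = A b . x, a multiple of b . x = 0.\<close>
    moreover have "A *v x \<in> ?W" if x: "x \<in> ?W" for x
    proof safe
      fix b assume b: "b \<in> B"
      then obtain c where "A *v b = c *\<^sub>R b"
        using B by (auto simp: P_def)
      then show "b \<bullet> (A *v x) = 0"
        using x b by (simp add: symmetric_matrix_inner[OF sym])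
    qed
    moreover have "y \<in> ?W"
      using y by (auto simp: orthogonal_def inner_commute span_base)
    ultimately obtain u c where u: "u \<in> ?W" "norm u = 1" "A *v u = c *\<^sub>R u"
      by (rule symmetric_matrix_eigenvector_in_subspace[OF sym _ _ _ y(1)])
    have "u \<notin> B"
      using u by (auto simp: norm_eq_1)
    moreover have "P (insert u B)"
      using B u by (auto simp: P_def pairwise_insert orthogonal_def inner_commute)
    ultimately show False
      using max[of "insert u B"] bound[OF B] by simp
  qed
  then obtain u where u: "bij_betw u (UNIV :: 'n set) B"
    using bound[OF B] finite_same_card_bij[of "UNIV :: 'n set" B] by auto
  then have uB: "u i \<in> B" for i
    by (auto simp: bij_betw_def)
  then have "\<forall>i. \<exists>c. A *v u i = c *\<^sub>R u i"
    using B by (simp add: P_def)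
  then obtain d where d: "A *v u i = d i *\<^sub>R u i" for i
    by (auto dest!: choice)
  have "u i \<bullet> u j = (if i = j then 1 else 0)" for i j
  proof (cases "i = j")
    case True
    then show ?thesis
      using B uB by (auto simp: P_def norm_eq_1)
  next
    case False
    then have "u i \<noteq> u j"
      using u by (auto simp: bij_betw_def inj_on_def)
    then show ?thesis
      using B uB False unfolding P_def pairwise_def orthogonal_def by auto
  qed
  then have "eigenframe A u d"
    using d by (simp add: eigenframe_def)
  then show ?thesis
    by (rule that)
qed

subsection \<open>Local constancy of the inertia at a nonsingular matrix\<close>

context orthonormal_frame
begin

lemma inner_eq_0_span:
  assumes "x \<in> span (u ` I)" "j \<notin> I"
  shows "u j \<bullet> x = 0"
proof -
  have "span (u ` I) \<subseteq> {x. u j \<bullet> x = 0}"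
    using assms(2) by (intro span_minimal subspace_hyperplane) (auto simp: orthonormal)
  then show ?thesis
    using assms(1) by auto
qed

lemma inj_frame: "inj u"
  by (metis injI orthonormal zero_neq_one)

lemma dim_span_image: "dim (span (u ` I)) = card I"
proof -
  have "independent (u ` I)"
  proof (rule pairwise_orthogonal_independent)
    show "pairwise orthogonal (u ` I)"
      by (auto simp: pairwise_def orthogonal_def orthonormal)
    show "0 \<notin> u ` I"
      by (metis imageE inner_zero_left orthonormal zero_neq_one)
  qed
  then show ?thesis
    using inj_frame by (simp add: dim_eq_card_independent card_image inj_on_subset)
qed

end

text \<open>Cauchy-Schwarz on every row; the matrix norm is the Frobenius norm.\<close>

lemma norm_matrix_vector_le:
  fixes A :: "real^'n::finite^'m::finite"
  shows "norm (A *v x) \<le> norm A * norm x"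
proof (rule power2_le_imp_le)
  have "(norm (A *v x))\<^sup>2 = (\<Sum>i\<in>UNIV. (A $ i \<bullet> x)\<^sup>2)"
    unfolding power2_norm_eq_inner inner_vec_def[of "A *v x"]
    by (simp add: matrix_vector_mul_component power2_eq_square)
  also have "\<dots> \<le> (\<Sum>i\<in>UNIV. (A $ i \<bullet> A $ i) * (x \<bullet> x))"
    by (intro sum_mono Cauchy_Schwarz_ineq)
  also have "\<dots> = (norm A * norm x)\<^sup>2"
    by (simp add: power_mult_distrib power2_norm_eq_inner inner_vec_def[of A] sum_distrib_right)
  finally show "(norm (A *v x))\<^sup>2 \<le> (norm A * norm x)\<^sup>2" .
qed simp

lemma dim_pos_subspace_le:
  assumes "eigenframe A w e" and E: "subspace E"
    and pos: "\<And>x. x \<in> E \<Longrightarrow> x \<noteq> 0 \<Longrightarrow> 0 < x \<bullet> (A *v x)"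
  shows "dim E \<le> card {i. 0 < e i}"
proof -
  \<comment> \<open>\<open>E\<close> meets the span of the eigenvectors with nonpositive eigenvalue only in \<open>0\<close>.\<close>
  interpret orthonormal_frame w
    using assms(1) by (rule eigenframe_orthonormal_frame)
  let ?I = "{i. e i \<le> 0}"
  let ?F = "span (w ` ?I)"
  have nonpos: "x \<bullet> (A *v x) \<le> 0" if "x \<in> ?F" for x
    unfolding eigenframe_eq_spectral_mat[OF assms(1)] inner_vector_spectral_mat
  proof (rule sum_nonpos)
    fix i
    show "e i * (w i \<bullet> x) * (w i \<bullet> x) \<le> 0"
      using inner_eq_0_span[OF that, of i]
      by (cases "e i \<le> 0") (auto simp: mult.assoc mult_nonpos_nonneg)
  qed
  have "E \<inter> ?F = {0}"
    using pos nonpos subspace_0[OF E] span_0 by (fastforce simp: not_le[symmetric])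
  then have "dim E + card ?I = dim {x + y |x y. x \<in> E \<and> y \<in> ?F}"
    using dim_sums_Int[OF E subspace_span, of "w ` ?I"] by (simp add: dim_span_image del: dim_span)
  also have "\<dots> \<le> CARD('a)"
    using dim_subset_UNIV[of "{x + y |x y. x \<in> E \<and> y \<in> ?F}"] by simp
  also have "CARD('a) = card ({i. 0 < e i} \<union> ?I)"
    by (rule arg_cong[of _ _ card]) auto
  also have "\<dots> = card {i. 0 < e i} + card ?I"
    by (rule card_Un_disjoint) auto
  finally show ?thesis by simp
qed

text \<open>On the span of the positive eigenvectors the form of A is at least r |x|^2, with r the
  least |d_i|. Passing to B changes it by at most \<open>norm (B - A)\<close> |x|^2, so B is still
  positive definite there.\<close>

lemma card_pos_eigenvalues_perturb_le:
  assumes A: "eigenframe A u d" and B: "eigenframe B w e"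
    and gap: "\<And>i. norm (B - A) < \<bar>d i\<bar>"
  shows "card {i. 0 < d i} \<le> card {i. 0 < e i}"
proof -
  interpret orthonormal_frame u
    using A by (rule eigenframe_orthonormal_frame)
  let ?E = "span (u ` {i. 0 < d i})"
  have "0 < x \<bullet> (B *v x)" if x: "x \<in> ?E" "x \<noteq> 0" for x
  proof -
    define r where "r = Min (range (\<lambda>i. \<bar>d i\<bar>))"
    have r: "norm (B - A) < r" "\<And>i. r \<le> \<bar>d i\<bar>"
      using gap by (auto simp: r_def)
    have "\<bar>x \<bullet> ((B - A) *v x)\<bar> \<le> norm x * (norm (B - A) * norm x)"
      by (rule order_trans[OF Cauchy_Schwarz_ineq2]) (intro mult_left_mono norm_matrix_vector_le norm_ge_zero)
    also have "\<dots> = norm (B - A) * (x \<bullet> x)"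
      by (simp add: norm_eq_sqrt_inner algebra_simps)
    also have "\<dots> < r * (x \<bullet> x)"
      using r x by simp
    also have "\<dots> = (\<Sum>i\<in>UNIV. r * (u i \<bullet> x) * (u i \<bullet> x))"
      by (subst inner_expand) (simp add: sum_distrib_left mult.assoc)
    also have "\<dots> \<le> (\<Sum>i\<in>UNIV. d i * (u i \<bullet> x) * (u i \<bullet> x))"
    proof (rule sum_mono)
      fix i
      \<comment> \<open>Coordinates with d_i \<le> 0 vanish on the span; for the others d_i = |d_i|
        \<ge> r.\<close>
      show "r * (u i \<bullet> x) * (u i \<bullet> x) \<le> d i * (u i \<bullet> x) * (u i \<bullet> x)"
        using inner_eq_0_span[OF x(1), of i] r(2)[of i]
        by (cases "0 < d i") (auto simp: mult.assoc intro!: mult_right_mono)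
    qed
    also have "\<dots> = x \<bullet> (A *v x)"
      by (simp add: eigenframe_eq_spectral_mat[OF A] inner_vector_spectral_mat)
    finally show ?thesis
      by (simp add: matrix_vector_mult_diff_rdistrib inner_diff_right)
  qed
  then show ?thesis
    using dim_pos_subspace_le[OF B subspace_span, of "u ` {i. 0 < d i}"] by (simp add: dim_span_image del: dim_span)
qed

lemma eigenframe_uminus: "eigenframe A u d \<Longrightarrow> eigenframe (- A) u (\<lambda>i. - d i)"
  by (auto simp: eigenframe_def matrix_vector_mult_diff_rdistrib[of 0, simplified])

text \<open>Neither the positive nor the negative count can drop. For A they already sum to the
  dimension, as the gap excludes zero eigenvalues, so neither can grow.\<close>

lemma inertia_perturb:
  assumes A: "eigenframe A u d" and sym: "transpose B = B"
    and gap: "\<And>i. norm (B - A) < \<bar>d i\<bar>"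
  shows "inertia B = inertia A"
proof -
  obtain w e where B: "eigenframe B w e"
    using symmetric_matrix_eigenframe[OF sym] .
  have pos: "card {i. 0 < d i} \<le> card {i. 0 < e i}"
    by (rule card_pos_eigenvalues_perturb_le[OF A B gap])
  have "norm (- B - - A) < \<bar>- d i\<bar>" for i
    using gap[of i] by (simp add: norm_minus_commute)
  from card_pos_eigenvalues_perturb_le[OF eigenframe_uminus[OF A] eigenframe_uminus[OF B] this]
  have neg: "card {i. d i < 0} \<le> card {i. e i < 0}"
    by simp
  have total: "card {i. 0 < f i} + card {i. f i = 0} + card {i. f i < 0} = CARD('a)" for f :: "'a \<Rightarrow> real"
  proof -
    have "CARD('a) = card ({i. 0 < f i} \<union> {i. f i = 0} \<union> {i. f i < 0})"
      by (rule arg_cong[of _ _ card]) auto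
    also have "\<dots> = card ({i. 0 < f i} \<union> {i. f i = 0}) + card {i. f i < 0}"
      by (rule card_Un_disjoint) auto
    also have "card ({i. 0 < f i} \<union> {i. f i = 0}) = card {i. 0 < f i} + card {i. f i = 0}"
      by (rule card_Un_disjoint) auto
    finally show ?thesis by simp
  qed
  have "d i \<noteq> 0" for i
    using gap[of i] norm_ge_zero[of "B - A"] by linarith
  then have "card {i. d i = 0} = 0"
    by simp
  moreover from this have "card {i. e i = 0} = 0" "card {i. 0 < e i} = card {i. 0 < d i}"
    "card {i. e i < 0} = card {i. d i < 0}"
    using pos neg total[of d] total[of e] by linarith+
  ultimately show ?thesis
    by (simp only: inertia_eigenframe[OF A] inertia_eigenframe[OF B])
qed

subsection \<open>Gradient and Hessian\<close>

lemma frechet_derivative_eq_gradient: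
  assumes "f differentiable (at x)"
  shows "frechet_derivative f (at x) w = gradient f x \<bullet> w"
proof -
  interpret linear "frechet_derivative f (at x)"
    using assms by (rule linear_frechet_derivative)
  have "frechet_derivative f (at x) w = frechet_derivative f (at x) (\<Sum>i\<in>UNIV. (w $ i) *\<^sub>R axis i 1)"
    using basis_expansion[of w] by (simp add: scalar_mult_eq_scaleR)
  then show ?thesis
    by (simp add: sum scaleR gradient_def partial_def inner_vec_def mult.commute)
qed

lemma has_derivative_gradient:
  assumes "f differentiable (at x)"
  shows "(f has_derivative (\<lambda>w. gradient f x \<bullet> w)) (at x)"
  using assms unfolding frechet_derivative_works
  by (simp add: frechet_derivative_eq_gradient[OF assms, abs_def])

lemma has_real_derivative_along_line:
  assumes "f differentiable (at (x + s *\<^sub>R w))"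
  shows "((\<lambda>s. f (x + s *\<^sub>R w)) has_real_derivative gradient f (x + s *\<^sub>R w) \<bullet> w) (at s)"
proof -
  have "((\<lambda>s. x + s *\<^sub>R w) has_derivative (\<lambda>h. h *\<^sub>R w)) (at s)"
    by (auto intro!: derivative_eq_intros)
  from has_derivative_compose[OF this has_derivative_gradient[OF assms]]
  show ?thesis
    by (simp add: has_field_derivative_def mult.commute[of _ "gradient _ _ \<bullet> _"])
qed

lemma gradient_axis: "gradient f x \<bullet> axis i 1 = partial i f x"
  by (simp add: gradient_def inner_axis)

lemma smooth_Ck: "smooth g \<Longrightarrow> Ck k g"
  by (simp add: smooth_def)

lemma smooth_differentiable: "smooth g \<Longrightarrow> g differentiable (at x)"
  using smooth_Ck[of g "Suc 0"] by simp

lemma smooth_partial_differentiable: "smooth g \<Longrightarrow> partial i g differentiable (at x)"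
  using smooth_Ck[of g "Suc (Suc 0)"] by simp

lemma smooth_continuous_partial_partial: "smooth g \<Longrightarrow> continuous_on UNIV (partial j (partial i g))"
  using smooth_Ck[of g "Suc (Suc 0)"] by simp

section \<open>Symmetry and continuity of the Hessian\<close>

lemma second_difference_mvt:
  fixes g :: "real^'n::finite \<Rightarrow> real"
  assumes g: "smooth g" and h: "h > 0"
  obtains s t where "0 < s" "s < h" "0 < t" "t < h"
    "g (x + h *\<^sub>R axis i 1 + h *\<^sub>R axis j 1) - g (x + h *\<^sub>R axis i 1) - g (x + h *\<^sub>R axis j 1) + g x
      = h * h * partial j (partial i g) (x + s *\<^sub>R axis i 1 + t *\<^sub>R axis j 1)"
proof -
  let ?a = "axis i 1 :: real^'n" and ?b = "axis j 1 :: real^'n"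
  \<comment> \<open>The increment of \<open>?\<phi>\<close> over [0, h] is the second difference;
    the mean value theorem is applied to \<open>?\<phi>\<close> in direction i, then to
    \<open>?\<psi>\<close> in direction j.\<close>
  let ?\<phi> = "\<lambda>s. g ((x + h *\<^sub>R ?b) + s *\<^sub>R ?a) - g (x + s *\<^sub>R ?a)"
  let ?\<phi>' = "\<lambda>s. partial i g ((x + h *\<^sub>R ?b) + s *\<^sub>R ?a) - partial i g (x + s *\<^sub>R ?a)"
  have "(?\<phi> has_real_derivative ?\<phi>' s) (at s)" for s
    unfolding gradient_axis[symmetric]
    by (intro DERIV_diff has_real_derivative_along_line smooth_differentiable g)
  then obtain s where s: "0 < s" "s < h" "?\<phi> h - ?\<phi> 0 = (h - 0) * ?\<phi>' s"
    using MVT2[of 0 h ?\<phi> ?\<phi>'] h by blast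
  let ?\<psi> = "\<lambda>t. partial i g ((x + s *\<^sub>R ?a) + t *\<^sub>R ?b)"
  let ?\<psi>' = "\<lambda>t. partial j (partial i g) ((x + s *\<^sub>R ?a) + t *\<^sub>R ?b)"
  have "(?\<psi> has_real_derivative ?\<psi>' t) (at t)" for t
    unfolding gradient_axis[symmetric, where f = "partial i g"]
    by (intro has_real_derivative_along_line smooth_partial_differentiable g)
  then obtain t where t: "0 < t" "t < h" "?\<psi> h - ?\<psi> 0 = (h - 0) * ?\<psi>' t"
    using MVT2[of 0 h ?\<psi> ?\<psi>'] h by blast
  have "?\<phi>' s = ?\<psi> h - ?\<psi> 0"
    by (simp add: algebra_simps)
  then have "?\<phi> h - ?\<phi> 0 = h * (h * ?\<psi>' t)"
    using s(3) t(3) by simp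
  then have "g (x + h *\<^sub>R ?a + h *\<^sub>R ?b) - g (x + h *\<^sub>R ?a) - g (x + h *\<^sub>R ?b) + g x = h * h * ?\<psi>' t"
    by (simp add: algebra_simps)
  with s t that show ?thesis by blast
qed

text \<open>Schwarz's theorem. The second difference is symmetric in i and j, so the two mixed
  partials share a value, taken at points arbitrarily near x, and continuity carries the equality to
  x.\<close>

lemma partial_partial_commute:
  fixes g :: "real^'n::finite \<Rightarrow> real"
  assumes g: "smooth g"
  shows "partial j (partial i g) x = partial i (partial j g) x"
proof (rule ccontr)
  let ?p = "partial j (partial i g)" and ?q = "partial i (partial j g)"
  assume neq: "?p x \<noteq> ?q x"
  \<comment> \<open>Half the gap, so that two errors below \<epsilon> cannot bridge it.\<close>
  define \<epsilon> where "\<epsilon> = \<bar>?p x - ?q x\<bar> / 2"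
  have \<epsilon>: "\<epsilon> > 0"
    using neq by (simp add: \<epsilon>_def)
  have near: "\<exists>\<delta>>0. \<forall>y. dist y x < \<delta> \<longrightarrow> dist (f y) (f x) < \<epsilon>"
    if "continuous_on UNIV f" for f :: "real^'n \<Rightarrow> real"
    using that \<epsilon> unfolding continuous_on_iff by (metis UNIV_I)
  obtain \<delta>1 where \<delta>1: "\<delta>1 > 0" "\<And>y. dist y x < \<delta>1 \<Longrightarrow> dist (?p y) (?p x) < \<epsilon>"
    using near[OF smooth_continuous_partial_partial[OF g, of j i]] by blast
  obtain \<delta>2 where \<delta>2: "\<delta>2 > 0" "\<And>y. dist y x < \<delta>2 \<Longrightarrow> dist (?q y) (?q x) < \<epsilon>"
    using near[OF smooth_continuous_partial_partial[OF g, of i j]] by blast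
  \<comment> \<open>Each sample point is reached from x by two steps shorter than h, so it stays
    within 2 h.\<close>
  define h where "h = min \<delta>1 \<delta>2 / 2"
  have h: "h > 0" "2 * h \<le> \<delta>1" "2 * h \<le> \<delta>2"
    using \<delta>1 \<delta>2 by (auto simp: h_def)
  have close: "dist (x + s *\<^sub>R axis k 1 + t *\<^sub>R axis l 1) x < 2 * h"
    if "0 < s" "s < h" "0 < t" "t < h" for s t and k l :: 'n
  proof -
    have "norm (s *\<^sub>R axis k 1 + t *\<^sub>R axis l 1 :: real^'n) \<le> \<bar>s\<bar> + \<bar>t\<bar>"
      by (rule norm_triangle_le) simp
    then show ?thesis
      using that by (simp add: dist_norm add.assoc)
  qed
  obtain s t where st: "0 < s" "s < h" "0 < t" "t < h"
    "g (x + h *\<^sub>R axis i 1 + h *\<^sub>R axis j 1) - g (x + h *\<^sub>R axis i 1) - g (x + h *\<^sub>R axis j 1) + g x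
      = h * h * ?p (x + s *\<^sub>R axis i 1 + t *\<^sub>R axis j 1)"
    using second_difference_mvt[OF g h(1)] by blast
  obtain s' t' where st': "0 < s'" "s' < h" "0 < t'" "t' < h"
    "g (x + h *\<^sub>R axis j 1 + h *\<^sub>R axis i 1) - g (x + h *\<^sub>R axis j 1) - g (x + h *\<^sub>R axis i 1) + g x
      = h * h * ?q (x + s' *\<^sub>R axis j 1 + t' *\<^sub>R axis i 1)"
    using second_difference_mvt[OF g h(1)] by blast
  have "h * h * ?p (x + s *\<^sub>R axis i 1 + t *\<^sub>R axis j 1) = h * h * ?q (x + s' *\<^sub>R axis j 1 + t' *\<^sub>R axis i 1)"
    unfolding st(5)[symmetric] st'(5)[symmetric] by (simp add: algebra_simps)
  then have "?p (x + s *\<^sub>R axis i 1 + t *\<^sub>R axis j 1) = ?q (x + s' *\<^sub>R axis j 1 + t' *\<^sub>R axis i 1)"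
    using h by simp
  moreover have "dist (?p (x + s *\<^sub>R axis i 1 + t *\<^sub>R axis j 1)) (?p x) < \<epsilon>"
    using close[OF st(1-4)] h by (intro \<delta>1) (rule less_le_trans)
  moreover have "dist (?q (x + s' *\<^sub>R axis j 1 + t' *\<^sub>R axis i 1)) (?q x) < \<epsilon>"
    using close[OF st'(1-4)] h by (intro \<delta>2) (rule less_le_trans)
  ultimately have "\<bar>?p x - ?q x\<bar> < 2 * \<epsilon>"
    unfolding dist_real_def by linarith
  then show False
    by (simp add: \<epsilon>_def)
qed

lemma transpose_hessian: "smooth g \<Longrightarrow> transpose (hessian g x) = hessian g x"
  by (simp add: hessian_def transpose_def vec_eq_iff partial_partial_commute)

lemma continuous_on_hessian: "smooth g \<Longrightarrow> continuous_on UNIV (hessian g)"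
  unfolding hessian_def by (intro continuous_on_vec_lambda smooth_continuous_partial_partial)

text \<open>Product rule on the sum of squares: row i of the Hessian is the gradient of the i-th
  partial derivative, so its product with w is the slope of that partial along w.\<close>

lemma has_real_derivative_half_grad_sq_along_line:
  assumes g: "smooth g"
  shows "((\<lambda>s. half_grad_sq g (x + s *\<^sub>R w)) has_real_derivative gradient g x \<bullet> (hessian g x *v w)) (at 0)"
proof -
  have "((\<lambda>s. partial i g (x + s *\<^sub>R w)) has_real_derivative (hessian g x *v w) $ i) (at 0)" for i
    using has_real_derivative_along_line[OF smooth_partial_differentiable[OF g], where x = x and s = 0 and w = w]
    by (simp add: hessian_def gradient_def matrix_vector_mult_def inner_vec_def)
  then have "((\<lambda>s. 1/2 * (\<Sum>i\<in>UNIV. partial i g (x + s *\<^sub>R w) * partial i g (x + s *\<^sub>R w)))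
      has_real_derivative (\<Sum>i\<in>UNIV. partial i g x * (hessian g x *v w) $ i)) (at 0)"
    by (auto intro!: derivative_eq_intros sum.cong simp: sum_distrib_left)
  then show ?thesis
    by (simp add: half_grad_sq_def inner_vec_def gradient_def)
qed

subsection \<open>The descent direction\<close>

lemma descendsI:
  assumes g: "smooth g"
    and grad: "gradient g x0 \<bullet> w < 0" and hess: "gradient g x0 \<bullet> (hessian g x0 *v w) < 0"
  shows "descends g x0 w"
proof -
  have "((\<lambda>s. g (x0 + s *\<^sub>R w)) has_real_derivative gradient g x0 \<bullet> w) (at 0)"
    using has_real_derivative_along_line[OF smooth_differentiable[OF g], where x = x0 and s = 0 and w = w] by simp
  from has_real_derivative_neg_dec_right[OF this grad]
  obtain d where d: "d > 0" "\<And>h. 0 < h \<Longrightarrow> h < d \<Longrightarrow> g (x0 + h *\<^sub>R w) < g x0"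
    by auto
  obtain e where e: "e > 0" "\<And>h. 0 < h \<Longrightarrow> h < e \<Longrightarrow> half_grad_sq g (x0 + h *\<^sub>R w) < half_grad_sq g x0"
    using has_real_derivative_neg_dec_right[OF has_real_derivative_half_grad_sq_along_line[OF g] hess] by auto
  \<comment> \<open>A single step length below both thresholds decreases both functions at
    once.\<close>
  have "0 < min d e / 2" "min d e / 2 < d" "min d e / 2 < e"
    using d(1) e(1) by auto
  then show ?thesis
    unfolding descends_def using d(2) e(2) by blast
qed

text \<open>The least modulus of an eigenvalue is a distance that \<open>inertia_perturb\<close>
  tolerates; continuity of the Hessian keeps short steps in any direction w within it.\<close>

lemma preserves_inertia_nonsingular:
  assumes g: "smooth g" and frame: "eigenframe (hessian g x0) u d" and nonsing: "\<And>i. d i \<noteq> 0"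
  shows "preserves_inertia g x0 w"
proof -
  define r where "r = Min (range (\<lambda>i. \<bar>d i\<bar>))"
  have r: "0 < r" "\<And>i. r \<le> \<bar>d i\<bar>"
    using nonsing by (auto simp: r_def)
  have "continuous_on UNIV (\<lambda>t. hessian g (x0 + t *\<^sub>R w))"
    by (rule continuous_on_compose2[OF continuous_on_hessian[OF g]]) (auto intro!: continuous_intros)
  then obtain \<delta> where \<delta>: "\<delta> > 0"
    "\<And>t. dist t 0 < \<delta> \<Longrightarrow> dist (hessian g (x0 + t *\<^sub>R w)) (hessian g (x0 + 0 *\<^sub>R w)) < r"
    using r(1) unfolding continuous_on_iff by (metis UNIV_I)
  then have "norm (hessian g (x0 + (\<delta> / 2) *\<^sub>R w) - hessian g x0) < r"
    using \<delta>(2)[of "\<delta> / 2"] by (simp add: dist_norm)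
  then have "inertia (hessian g (x0 + (\<delta> / 2) *\<^sub>R w)) = inertia (hessian g x0)"
    using r(2) by (intro inertia_perturb[OF frame] transpose_hessian[OF g]) (rule less_le_trans)
  then show ?thesis
    unfolding preserves_inertia_def using \<delta>(1) half_gt_zero by blast
qed

text \<open>The closest semidefinite matrix and the pseudoinverse occur both as relations and as
  values of the \<open>THE\<close> terms, so that existence is part of the claim. The bijection
  \<open>idxp\<close> forces \<open>'p\<close> to have \<open>np\<close> elements.\<close>

theorem proposition9:
  fixes g :: "real^'n::finite \<Rightarrow> real"
    and \<Omega> :: "(real^'n) set"
    and x0 :: "real^'n"
    and np n0 nm :: nat
    and lam :: "nat \<Rightarrow> real"
    and v :: "nat \<Rightarrow> real^'n"
    and idx :: "'n \<Rightarrow> nat"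
    and idxp :: "'p::finite \<Rightarrow> nat"
    and V \<Lambda> D :: "real^'n^'n"
    and Vp :: "real^'p^'n"
    and \<Lambda>p :: "real^'p^'p"
  assumes smooth: "smooth g"
    and connected: "path_connected \<Omega>"
    and inertia: "\<And>x. x \<in> \<Omega> \<Longrightarrow> inertia (hessian g x) = (np, n0, nm)"
    and np: "np \<ge> 1"
    and x0: "x0 \<in> \<Omega>"
    and eigenvector: "\<And>i. i \<in> {1..CARD('n)} \<Longrightarrow> hessian g x0 *v v i = lam i *\<^sub>R v i"
    and orthonormal: "\<And>i j. i \<in> {1..CARD('n)} \<Longrightarrow> j \<in> {1..CARD('n)} \<Longrightarrow>
                        v i \<bullet> v j = (if i = j then 1 else 0)"
    and ordered: "\<And>i j. 1 \<le> i \<Longrightarrow> i \<le> j \<Longrightarrow> j \<le> CARD('n) \<Longrightarrow> lam j \<le> lam i"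
    \<comment> \<open>numberings of the index types, so that matrices can have columns \<open>v 1, v 2, \<dots>\<close>\<close>
    and idx: "bij_betw idx UNIV {1..CARD('n)}"
    and idxp: "bij_betw idxp UNIV {1..np}"
    and V: "V = (\<chi> i j. v (idx j) $ i)"
    and Vp: "Vp = (\<chi> i k. v (idxp k) $ i)"
    and \<Lambda>: "\<Lambda> = diag_mat (\<lambda>j. lam (idx j))"
    and D: "D = diag_mat (\<lambda>j. if idx j \<le> np then lam (idx j) else 0)"
    and \<Lambda>p: "\<Lambda>p = diag_mat (\<lambda>k. lam (idxp k))"
  shows "(transpose Vp *v gradient g x0 \<noteq> 0 \<longrightarrow>
            (\<exists>w. descends g x0 w \<and> (n0 = 0 \<longrightarrow> preserves_inertia g x0 w)) \<and>
            (let w = - (pinv (nearest_psd (hessian g x0)) *v gradient g x0)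
             in descends g x0 w \<and> (n0 = 0 \<longrightarrow> preserves_inertia g x0 w))) \<and>
         hessian g x0 = V ** \<Lambda> ** transpose V \<and>
         is_nearest_psd (hessian g x0) (V ** D ** transpose V) \<and>
         nearest_psd (hessian g x0) = V ** D ** transpose V \<and>
         is_pinv (nearest_psd (hessian g x0)) (Vp ** matrix_inv \<Lambda>p ** transpose Vp) \<and>
         pinv (nearest_psd (hessian g x0)) = Vp ** matrix_inv \<Lambda>p ** transpose Vp"
proof -
  define u where "u j = v (idx j)" for j
  define d where "d j = lam (idx j)" for j
  \<comment> \<open>The weights of the pseudoinverse of H_+; they vanish where d_j \<le> 0, since
    \<open>inverse 0 = 0\<close>.\<close>
  define e where "e j = inverse (max 0 (d j))" for j
  let ?H = "hessian g x0" and ?grad = "gradient g x0"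
  have idx_range: "idx j \<in> {1..CARD('n)}" for j
    using idx by (auto simp: bij_betw_def)
  have frame: "eigenframe ?H u d"
    using idx_range eigenvector orthonormal bij_betw_imp_inj_on[OF idx]
    by (auto simp: eigenframe_def u_def d_def dest: injD)
  interpret orthonormal_frame u
    using frame by (rule eigenframe_orthonormal_frame)
  have H: "?H = spectral_mat u d"
    by (rule eigenframe_eq_spectral_mat[OF frame])
  have counts: "card {j. 0 < d j} = np" "card {j. d j = 0} = n0"
    using inertia[OF x0] inertia_eigenframe[OF frame] by auto
  \<comment> \<open>Carries the count of positive eigenvalues from the index type \<open>'n\<close>
    to positions in the ordered list.\<close>
  have "bij_betw idx {j. 0 < d j} {i \<in> {1..CARD('n)}. 0 < lam i}"
    using idx idx_range unfolding bij_betw_def d_def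
    by (safe intro!: imageI) (auto simp: inj_on_def dest!: equalityD2[THEN subsetD])
  then have card_pos: "card {i \<in> {1..CARD('n)}. 0 < lam i} = np"
    using counts(1) bij_betw_same_card by fastforce
  have pos_iff: "0 < lam i \<longleftrightarrow> i \<le> np" if "i \<in> {1..CARD('n)}" for i
    unfolding card_pos[symmetric] by (rule pos_iff_le_card_pos[OF _ that]) (rule ordered)
  have np_le: "np \<le> CARD('n)"
    unfolding counts(1)[symmetric] by (intro card_mono) auto
  have idxp_range: "idxp k \<in> {1..np}" for k
    using idxp by (auto simp: bij_betw_def)
  then have lam_idxp: "0 < lam (idxp k)" for k
    using pos_iff[of "idxp k"] np_le by (meson atLeastAtMost_iff order_trans)
  have V_eq: "V = col_mat u"
    by (simp add: V col_mat_def u_def)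
  have HV: "?H = V ** \<Lambda> ** transpose V"
    using H by (simp add: spectral_mat_def V_eq \<Lambda> d_def[abs_def])
  \<comment> \<open>Cutting off by position, as in D, agrees with cutting off by sign.\<close>
  have "(if idx j \<le> np then lam (idx j) else 0) = max 0 (d j)" for j
    using pos_iff[OF idx_range, of j] by (auto simp: d_def max_def)
  then have VD: "V ** D ** transpose V = spectral_mat u (\<lambda>j. max 0 (d j))"
    by (simp add: D V_eq spectral_mat_def)
  have nearest: "is_nearest_psd ?H (V ** D ** transpose V)"
    unfolding VD H by (rule is_nearest_psd_spectral_mat)
  then have nearest_eq: "nearest_psd ?H = V ** D ** transpose V"
    by (rule nearest_psd_eqI)
  have X: "Vp ** matrix_inv \<Lambda>p ** transpose Vp = spectral_mat u e"
  proof -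
    have inv: "matrix_inv \<Lambda>p = diag_mat (\<lambda>k. inverse (lam (idxp k)))"
      unfolding \<Lambda>p using lam_idxp by (intro matrix_inv_diag_mat) (metis less_irrefl)
    have "(\<Sum>k\<in>UNIV. inverse (lam (idxp k)) * (v (idxp k) $ a * v (idxp k) $ b))
        = (\<Sum>j\<in>UNIV. e j * (u j $ a * u j $ b))" for a b
    proof -
      have "(\<Sum>k\<in>UNIV. inverse (lam (idxp k)) * (v (idxp k) $ a * v (idxp k) $ b))
          = (\<Sum>i=1..np. inverse (lam i) * (v i $ a * v i $ b))"
        by (rule sum.reindex_bij_betw[OF idxp])
      \<comment> \<open>Positions beyond \<open>np\<close> have nonpositive eigenvalues and thus
        coefficient \<open>inverse 0 = 0\<close>, so the sum extends to the full frame.\<close>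
      also have "\<dots> = (\<Sum>i=1..CARD('n). inverse (max 0 (lam i)) * (v i $ a * v i $ b))"
      proof (rule sum.mono_neutral_cong_left)
        show "\<forall>i\<in>{1..CARD('n)} - {1..np}. inverse (max 0 (lam i)) * (v i $ a * v i $ b) = 0"
        proof
          fix i assume i: "i \<in> {1..CARD('n)} - {1..np}"
          then have "max 0 (lam i) = 0"
            using pos_iff[of i] by (simp add: max_def not_less)
          then show "inverse (max 0 (lam i)) * (v i $ a * v i $ b) = 0"
            by simp
        qed
        show "inverse (lam i) * (v i $ a * v i $ b) = inverse (max 0 (lam i)) * (v i $ a * v i $ b)"
          if "i \<in> {1..np}" for i
          using pos_iff[of i] that np_le by (simp add: max_def)
      qed (use np_le in auto)
      also have "\<dots> = (\<Sum>j\<in>UNIV. inverse (max 0 (lam (idx j))) * (v (idx j) $ a * v (idx j) $ b))"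
        by (rule sum.reindex_bij_betw[OF idx, symmetric])
      finally show ?thesis
        by (simp add: e_def d_def u_def)
    qed
    then have "col_mat (\<lambda>k. v (idxp k)) ** matrix_inv \<Lambda>p ** transpose (col_mat (\<lambda>k. v (idxp k)))
        = spectral_mat u e"
      unfolding inv by (simp add: vec_eq_iff col_mat_diag_component spectral_mat_component)
    then show ?thesis
      by (simp add: Vp col_mat_def)
  qed
  have pinv: "is_pinv (nearest_psd ?H) (Vp ** matrix_inv \<Lambda>p ** transpose Vp)"
    unfolding nearest_eq VD X e_def[abs_def] by (rule is_pinv_spectral_mat)
  then have pinv_eq: "pinv (nearest_psd ?H) = Vp ** matrix_inv \<Lambda>p ** transpose Vp"
    by (rule pinv_eqI)
  have descends: "descends g x0 (- (spectral_mat u e *v ?grad))" if nz: "transpose Vp *v ?grad \<noteq> 0"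
  proof -
    obtain k where "v (idxp k) \<bullet> ?grad \<noteq> 0"
      using nz by (auto simp: Vp transpose_col_mat_vector[unfolded col_mat_def] vec_eq_iff simp del: transpose_matrix_vector)
    \<comment> \<open>Locates the same eigenvector in the full frame.\<close>
    moreover obtain j where j: "idx j = idxp k"
      using idx idxp_range[of k] np_le by (metis UNIV_I atLeastAtMost_iff bij_betw_iff_bijections order_trans)
    ultimately have uj: "u j \<bullet> ?grad \<noteq> 0" and dj: "0 < d j"
      using lam_idxp[of k] by (simp_all add: u_def d_def)
    \<comment> \<open>The weights \<open>d i * e i\<close> are 1 or 0: H X is the orthogonal
      projection onto the span of the positive eigenvectors.\<close>
    have e_nonneg: "0 \<le> e i" "0 \<le> d i * e i" for i
      by (auto simp: e_def max_def)
    have e_pos: "0 < e j" "0 < d j * e j"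
      using dj by (auto simp: e_def max_def)
    have "0 < ?grad \<bullet> (spectral_mat u e *v ?grad)"
      using e_nonneg(1) e_pos(1) uj by (rule inner_spectral_mat_pos)
    moreover have "0 < ?grad \<bullet> (?H *v (spectral_mat u e *v ?grad))"
      unfolding H matrix_vector_mul_assoc spectral_mat_mult
      using e_nonneg(2) e_pos(2) uj by (rule inner_spectral_mat_pos)
    ultimately show ?thesis
      by (intro descendsI[OF smooth])
        (simp_all add: matrix_vector_mult_diff_distrib[of _ 0, simplified])
  qed
  have preserves: "preserves_inertia g x0 w" if "n0 = 0" for w
    using counts(2) that by (intro preserves_inertia_nonsingular[OF smooth frame]) auto
  show ?thesis
    unfolding Let_def pinv_eq X
    using descends preserves HV nearest nearest_eq pinv X by auto
qed

end
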